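(* Let $n\in\mathbb{N}$, $d\in\mathbb{N}_0$, $N:=\dim\mathbb{R}[x_1,\dots,x_n]_{\leq d}=\binom{n+d}{n}$. Let $S\subseteq\mathbb{R}[x_1,\dots,x_n]_{\leq d}$, let $C\subseteq\mathbb{R}[x_1,\dots,x_n]_{\leq d}$ be a full dimensional cone, let $l:\mathbb{R}[x_1,\dots,x_n]_{\leq d}\to\mathbb{R}$ be a linear functional with $l(p)>0$ for all $p\in(\overline{\mathrm{cone}\,S}\cup C)\setminus\{0\}$, let $f\in\mathrm{int}\,C$, let $Ap:=l(p)\cdot f$ for $p\in\mathbb{R}[x_1,\dots,x_n]_{\leq d}$, and let $\tau>0$ be such that $e^{tA}S\subseteq C$ for all $t\geq\tau$. Set $T:=e^{\tau A}$ and $c:=e^{\tau\cdot l(f)}$. Fix a basis $\mathcal{B}$ of $\mathbb{R}[x_1,\dots,x_n]_{\leq d}$, let $\tilde T\in\mathbb{R}^{N\times N}$ be the matrix of $T$ in $\mathcal{B}$, let $\tilde f\in\mathbb{R}^N$ be the coefficient column vector of $l(f)^{-1}\cdot f$ in $\mathcal{B}$, and let $\tilde l$ be the row vector of length $N$ representing $l$ in $\mathcal{B}$. Then: (1) $\tilde T=I_N+(c-1)\,\tilde f\,\tilde l$, so that $\tilde T$ is determined by (and can be stored as) the triple $(\tilde f,c,\tilde l)\in\mathbb{R}^{2N+1}$. (2) $\tilde T^{-1}=I_N+(c^{-1}-1)\,\tilde f\,\tilde l$, i.e. $\tilde T^{-1}$ is stored as the triple $(\tilde f,c^{-1},\tilde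 l)$, and this triple is obtained from the triple of $\tilde T$ by one arithmetic operation (a division). (3) For every $M\in\mathbb{R}^{N\times N}$, each of the products $M\tilde T$ and $\tilde TM$ can be computed from $M$ and the triple of $\tilde T$, and each of the products $M\tilde T^{-1}$ and $\tilde T^{-1}M$ can be computed from $M$ and the triple of $\tilde T^{-1}$, with at most $4N^2+1$ arithmetic operations. (4) For every $v\in\mathbb{R}^N$, $\tilde Tv$ can be computed from $v$ and the triple of $\tilde T$, and $\tilde T^{-1}v$ can be computed from $v$ and the triple of $\tilde T^{-1}$, with at most $4N+1$ arithmetic operations.
   Context: $\mathbb{R}[x_1,\dots,x_n]_{\leq d}$ is the finite dimensional real vector space of polynomials of total degree at most $d$, with its usual topology; closure and interior are taken in it. A cone is a set containing $0$ and closed under multiplication by non-negative reals; it is full dimensional if it has non-empty interior; $\mathrm{cone}\,S=\{\lambda s:\lambda\geq0,\ s\in S\}$. $e^{tA}$ is the usual exponential of an endomorphism of a finite dimensional space. $I_N$ is the $N\times N$ identity matrix. An arithmetic operation is a single addition, subtraction, multiplication or division of two real numbers; the complexity is counted in this exact real arithmetic (straight-line computation) model. *)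

theory Defs
  imports
    "Jordan_Normal_Form.Matrix"
    "HOL-Analysis.Function_Topology"
    "HOL-Library.Poly_Mapping"
begin

subsection \<open>Polynomials of bounded degree\<close>

text \<open>
  A monomial in \<open>x\<^sub>1, x\<^sub>2, \<dots>\<close> is a finitely supported exponent function, a polynomial a
  finitely supported coefficient function on monomials.
\<close>

type_synonym mpoly = "(nat \<Rightarrow>\<^sub>0 nat) \<Rightarrow>\<^sub>0 real"

instantiation poly_mapping :: (type, real_vector) real_vector
begin

definition scaleR_poly_mapping :: "real \<Rightarrow> ('a \<Rightarrow>\<^sub>0 'b) \<Rightarrow> ('a \<Rightarrow>\<^sub>0 'b)" where
  "scaleR_poly_mapping r p = Poly_Mapping.map (\<lambda>a. r *\<^sub>R a) p"

instance
proof -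
  have [simp]: "Poly_Mapping.lookup (r *\<^sub>R p) k = r *\<^sub>R Poly_Mapping.lookup p k"
    for r :: real and p :: "'a \<Rightarrow>\<^sub>0 'b" and k
    by (cases "Poly_Mapping.lookup p k = 0")
      (simp_all add: scaleR_poly_mapping_def Poly_Mapping.map.rep_eq)
  show "OFCLASS('a \<Rightarrow>\<^sub>0 'b, real_vector_class)"
    by standard
      (auto intro!: poly_mapping_eqI simp: Poly_Mapping.lookup_add scaleR_add_right scaleR_add_left)
qed

end

definition polys :: "nat \<Rightarrow> nat \<Rightarrow> mpoly set" where
  "polys n d =
     {p. \<forall>m \<in> Poly_Mapping.keys p.
           Poly_Mapping.keys m \<subseteq> {1..n} \<and> (\<Sum>i = 1..n. Poly_Mapping.lookup m i) \<le> d}"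

text \<open>
  The usual topology of this finite dimensional space is that of coefficientwise convergence: the
  subset carries the topology pulled back along the coefficient map from the product topology.
\<close>

definition poly_top :: "nat \<Rightarrow> nat \<Rightarrow> mpoly topology" where
  "poly_top n d = pullback_topology (polys n d) Poly_Mapping.lookup euclidean"

definition is_cone :: "'a::real_vector set \<Rightarrow> bool" where
  "is_cone C \<longleftrightarrow> 0 \<in> C \<and> (\<forall>p \<in> C. \<forall>r \<ge> 0. r *\<^sub>R p \<in> C)"

definition cone_of :: "'a::real_vector set \<Rightarrow> 'a set" where
  "cone_of S = {r *\<^sub>R s | r s. r \<ge> 0 \<and> s \<in> S}"

definition full_dim :: "nat \<Rightarrow> nat \<Rightarrow> mpoly set \<Rightarrow> bool" where
  "full_dim n d C \<longleftrightarrow> poly_top n d interior_of C \<noteq> {}"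

text \<open>Only the values on the given subspace are constrained.\<close>

definition linear_functional_on :: "'a::real_vector set \<Rightarrow> ('a \<Rightarrow> real) \<Rightarrow> bool" where
  "linear_functional_on V l \<longleftrightarrow>
     (\<forall>p \<in> V. \<forall>q \<in> V. l (p + q) = l p + l q) \<and> (\<forall>r. \<forall>p \<in> V. l (r *\<^sub>R p) = r * l p)"

text \<open>
  The exponential of an endomorphism of the space of polynomials, as the limit of the exponential
  series evaluated at \<open>p\<close>. Only meaningful for \<open>p \<in> polys n d\<close>.
\<close>

definition endo_exp :: "nat \<Rightarrow> nat \<Rightarrow> (mpoly \<Rightarrow> mpoly) \<Rightarrow> mpoly \<Rightarrow> mpoly" where
  "endo_exp n d A p =
     (THE q. limitin (poly_top n d) (\<lambda>K. \<Sum>k<K. (1 / fact k) *\<^sub>R (A ^^ k) p) q sequentially)"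


subsection \<open>Coordinates\<close>

definition is_basis :: "'a::real_vector set \<Rightarrow> 'a list \<Rightarrow> bool" where
  "is_basis V bs \<longleftrightarrow> distinct bs \<and> independent (set bs) \<and> span (set bs) = V"

definition coord_vec :: "'a::real_vector list \<Rightarrow> 'a \<Rightarrow> real vec" where
  "coord_vec bs p = vec (length bs) (\<lambda>i. representation (set bs) p (bs ! i))"

definition matrix_in :: "'a::real_vector list \<Rightarrow> ('a \<Rightarrow> 'a) \<Rightarrow> real mat" where
  "matrix_in bs T = mat_of_cols (length bs) (map (\<lambda>b. coord_vec bs (T b)) bs)"

definition functional_vec :: "'a::real_vector list \<Rightarrow> ('a \<Rightarrow> real) \<Rightarrow> real vec" where
  "functional_vec bs l = vec (length bs) (\<lambda>j. l (bs ! j))"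

text \<open>The product of \<open>u\<close> as a column and \<open>w\<close> as a row, an \<open>N \<times> N\<close> matrix.\<close>

definition col_times_row :: "nat \<Rightarrow> real vec \<Rightarrow> real vec \<Rightarrow> real mat" where
  "col_times_row N u w = mat_of_cols N [u] * mat_of_rows N [w]"


subsection \<open>Straight-line programs over the reals\<close>

text \<open>
  The memory initially holds the input; each instruction performs one arithmetic operation and
  appends its result to the memory. Operands and outputs are memory cells or real constants, and
  reading them is free. Undefined cells and division by 0 make the run fail.
\<close>

datatype arith_op = Add | Sub | Mul | Div

datatype operand = Cell nat | Const real

datatype instr = Instr arith_op operand operand

datatype slp = SLP (instrs: "instr list") (outputs: "operand list")

fun read_operand :: "real list \<Rightarrow> operand \<Rightarrow> real option" where
  "read_operand mem (Cell i) = (if i < length mem then Some (mem ! i) else None)"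
| "read_operand mem (Const r) = Some r"

fun apply_op :: "arith_op \<Rightarrow> real \<Rightarrow> real \<Rightarrow> real option" where
  "apply_op Add x y = Some (x + y)"
| "apply_op Sub x y = Some (x - y)"
| "apply_op Mul x y = Some (x * y)"
| "apply_op Div x y = (if y = 0 then None else Some (x / y))"

fun exec :: "instr list \<Rightarrow> real list \<Rightarrow> real list option" where
  "exec [] mem = Some mem"
| "exec (Instr oper a b # is) mem =
     Option.bind (read_operand mem a) (\<lambda>x.
     Option.bind (read_operand mem b) (\<lambda>y.
     Option.bind (apply_op oper x y) (\<lambda>z. exec is (mem @ [z]))))"

definition run :: "slp \<Rightarrow> real list \<Rightarrow> real list option" where
  "run P inp =
     Option.bind (exec (instrs P) inp) (\<lambda>mem. those (map (read_operand mem) (outputs P)))"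

definition cost :: "slp \<Rightarrow> nat" where
  "cost P = length (instrs P)"

definition mat_data :: "real mat \<Rightarrow> real list" where
  "mat_data M = concat (mat_to_list M)"

definition triple_data :: "real vec \<Rightarrow> real \<Rightarrow> real vec \<Rightarrow> real list" where
  "triple_data u a w = list_of_vec u @ [a] @ list_of_vec w"

end

theory Submission
  imports Defs
begin

text \<open>
  Since \<open>A\<close> has rank one, \<open>A\<^sup>k p = l(f)\<^bsup>k-1\<^esup> l(p) f\<close> for \<open>k \<ge> 1\<close>, and the exponential series sums to
  \<open>e\<^bsup>\<tau>A\<^esup> p = p + (c - 1) l(p) f / l(f)\<close>. Here \<open>l(f) > 0\<close> because \<open>f \<noteq> 0\<close>: if \<open>0\<close> were interior to \<open>C\<close>,
  then \<open>C\<close> would contain both \<open>\<epsilon>\<close> and \<open>-\<epsilon>\<close> for a small constant polynomial \<open>\<epsilon>\<close>, on which \<open>l\<close>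
  cannot be positive simultaneously. Normalising \<open>f\<close> makes the row times the column equal to 1,
  so that \<open>a \<mapsto> I + (a - 1) f l\<close> is multiplicative, which gives the inverse. The operation counts
  come from factoring the rank one correction: one matrix-vector product, one outer product, one
  matrix addition.
\<close>

subsection \<open>Closure properties of straight-line computability\<close>

text \<open>
  A set \<open>X\<close> of functions of a parameter \<open>p \<in> D\<close> is computable if a single program, run on the input
  \<open>inp p\<close>, leaves the value of each of them in a place \<open>addr x\<close> that does not depend on \<open>p\<close>. Working
  with sets of functions hides all memory addresses from the programs below.
\<close>

definition computable ::
    "'p set \<Rightarrow> ('p \<Rightarrow> real list) \<Rightarrow> nat \<Rightarrow> ('p \<Rightarrow> real) set \<Rightarrow> bool" where
  "computable D inp k X \<longleftrightarrow>
     (\<exists>is mem L addr. length is \<le> k \<and>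
        (\<forall>p\<in>D. exec is (inp p) = Some (mem p) \<and> length (mem p) = L \<and>
           (\<forall>x\<in>X. read_operand (mem p) (addr x) = Some (x p))))"

lemma exec_append: "exec (is @ js) mem = Option.bind (exec is mem) (exec js)"
proof (induction "is" arbitrary: mem)
  case (Cons i "is")
  show ?case
  proof (cases i)
    case (Instr oper a b)
    then show ?thesis by (simp add: Cons.IH Option.bind_assoc)
  qed
qed simp

lemma read_operand_append:
  "read_operand mem a = Some r \<Longrightarrow> read_operand (mem @ zs) a = Some r"
  by (cases a) (auto simp: nth_append split: if_splits)

lemma computable_mono:
  assumes "computable D inp k X" "Y \<subseteq> X" "k \<le> k'"
  shows "computable D inp k' Y"
proof -
  obtain "is" mem L addr where *: "length is \<le> k" "\<forall>p\<in>D. exec is (inp p) = Some (mem p) \<and>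
      length (mem p) = L \<and> (\<forall>x\<in>X. read_operand (mem p) (addr x) = Some (x p))"
    using assms(1) unfolding computable_def by blast
  show ?thesis
    unfolding computable_def
    by (rule exI[of _ "is"], rule exI[of _ mem], rule exI[of _ L], rule exI[of _ addr])
      (use * assms(2,3) in auto)
qed

lemma computable_input:
  assumes "\<And>p. p \<in> D \<Longrightarrow> length (inp p) = L"
    and "\<And>x. x \<in> X \<Longrightarrow> \<exists>i<L. \<forall>p\<in>D. inp p ! i = x p"
  shows "computable D inp 0 X"
proof -
  obtain g where g: "\<forall>x\<in>X. g x < L \<and> (\<forall>p\<in>D. inp p ! g x = x p)"
    using assms(2) by metis
  show ?thesis
    unfolding computable_def
    by (rule exI[of _ "[]"], rule exI[of _ inp], rule exI[of _ L], rule exI[of _ "\<lambda>x. Cell (g x)"])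
      (use g assms(1) in auto)
qed

text \<open>Operands may be literal constants, so a constant function needs an address but no
  instruction.\<close>

lemma computable_const:
  assumes "computable D inp k X"
  shows "computable D inp k (insert (\<lambda>_. r) X)"
proof -
  obtain "is" mem L addr where *: "length is \<le> k" "\<forall>p\<in>D. exec is (inp p) = Some (mem p) \<and>
      length (mem p) = L \<and> (\<forall>x\<in>X. read_operand (mem p) (addr x) = Some (x p))"
    using assms unfolding computable_def by blast
  show ?thesis
    unfolding computable_def
    by (rule exI[of _ "is"], rule exI[of _ mem], rule exI[of _ L],
        rule exI[of _ "addr(\<lambda>_. r := Const r)"]) (use * in auto)
qed

text \<open>Memory only grows at its end, so old addresses stay valid, and the new value lands in
  cell \<open>L\<close> for every parameter. This is why \<open>computable\<close> demands a memory
  length independent of the parameter.\<close>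

lemma computable_op:
  assumes "computable D inp k X" "x \<in> X" "y \<in> X"
    and "\<And>p. p \<in> D \<Longrightarrow> apply_op oper (x p) (y p) = Some (z p)"
  shows "computable D inp (Suc k) (insert z X)"
proof -
  obtain "is" mem L addr where *: "length is \<le> k" "\<forall>p\<in>D. exec is (inp p) = Some (mem p) \<and>
      length (mem p) = L \<and> (\<forall>x\<in>X. read_operand (mem p) (addr x) = Some (x p))"
    using assms(1) unfolding computable_def by blast
  show ?thesis
    unfolding computable_def
    by (rule exI[of _ "is @ [Instr oper (addr x) (addr y)]"], rule exI[of _ "\<lambda>p. mem p @ [z p]"],
        rule exI[of _ "Suc L"], rule exI[of _ "addr(z := Cell L)"])
      (use * assms(2-4) in \<open>auto simp: exec_append read_operand_append\<close>)
qed

text \<open>Outputs are read off at the recorded addresses free of charge, so only the instructions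
  count.\<close>

lemma computable_run:
  assumes "computable D inp k X" "set xs \<subseteq> X"
  shows "\<exists>P. cost P \<le> k \<and> (\<forall>p\<in>D. run P (inp p) = Some (map (\<lambda>x. x p) xs))"
proof -
  obtain "is" mem L addr where *: "length is \<le> k" "\<forall>p\<in>D. exec is (inp p) = Some (mem p) \<and>
      length (mem p) = L \<and> (\<forall>x\<in>X. read_operand (mem p) (addr x) = Some (x p))"
    using assms unfolding computable_def by blast
  have "those (map (read_operand (mem p)) (map addr xs)) = Some (map (\<lambda>x. x p) xs)"
    if "p \<in> D" for p
    using assms(2) by (induction xs) (use * that in auto)
  with * show ?thesis
    by (intro exI[of _ "SLP is (map addr xs)"]) (auto simp: cost_def run_def)
qed

section \<open>Families of values, sums and inner products\<close>

text \<open>\<open>step\<close> is demanded for every \<open>Y\<close> above \<open>X\<close>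
  because the results for earlier indices are already stored when the next index is
  processed.\<close>

lemma computable_family:
  assumes "finite I" "computable D inp k X"
    and step: "\<And>i k' Y. i \<in> I \<Longrightarrow> X \<subseteq> Y \<Longrightarrow> computable D inp k' Y \<Longrightarrow>
      computable D inp (k' + c) (insert (z i) Y)"
  shows "computable D inp (k + card I * c) (X \<union> z ` I)"
  using assms(1,3)
proof (induction I)
  case (insert i I)
  then have "computable D inp (k + card I * c + c) (insert (z i) (X \<union> z ` I))"
    by auto
  then show ?case
    using insert(1,2) by (simp add: algebra_simps)
qed (use assms(2) in simp)

lemma computable_family_op:
  assumes "computable D inp k X" "finite I" "\<And>i. i \<in> I \<Longrightarrow> x i \<in> X" "\<And>i. i \<in> I \<Longrightarrow> y i \<in> X"
    and "\<And>i p. p \<in> D \<Longrightarrow> apply_op oper (x i p) (y i p) = Some (z i p)"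
  shows "computable D inp (k + card I) (X \<union> z ` I)"
proof -
  have "computable D inp (k + card I * 1) (X \<union> z ` I)"
    using assms(2,1)
  proof (rule computable_family)
    fix i k' Y assume "i \<in> I" "X \<subseteq> Y" "computable D inp k' Y"
    then show "computable D inp (k' + 1) (insert (z i) Y)"
      using computable_op[of D inp k' Y "x i" "y i" oper "z i"] assms by auto
  qed
  then show ?thesis by simp
qed

lemma computable_sum:
  assumes "computable D inp k X" "\<And>j. j < Suc m \<Longrightarrow> x j \<in> X"
  shows "computable D inp (k + m) (insert (\<lambda>p. \<Sum>j<Suc m. x j p) X)"
  using assms(2)
proof (induction m)
  case 0
  \<comment> \<open>A sum with one term is \<open>x 0\<close>, already available, so the first term
    costs no addition.\<close>
  then show ?case using assms(1) by (simp add: insert_absorb)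
next
  case (Suc m)
  have "computable D inp (Suc (k + m)) (insert (\<lambda>p. \<Sum>j<Suc (Suc m). x j p)
      (insert (\<lambda>p. \<Sum>j<Suc m. x j p) X))"
    by (rule computable_op[where oper = Add and x = "\<lambda>p. \<Sum>j<Suc m. x j p" and y = "x (Suc m)"])
      (use Suc in auto)
  then show ?case
    by (rule computable_mono) auto
qed

text \<open>\<open>m\<close> multiplications are followed by \<open>m - 1\<close> additions.\<close>

lemma computable_inner_product:
  assumes "computable D inp k X" "m \<ge> 1"
    and "\<And>j. j < m \<Longrightarrow> x j \<in> X" "\<And>j. j < m \<Longrightarrow> y j \<in> X"
  shows "computable D inp (k + (2 * m - 1)) (insert (\<lambda>p. \<Sum>j<m. x j p * y j p) X)"
proof -
  obtain m' where m: "m = Suc m'" using assms(2) by (cases m) auto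
  let ?z = "\<lambda>j p. x j p * y j p"
  have "computable D inp (k + card {..<m}) (X \<union> ?z ` {..<m})"
    by (rule computable_family_op[where oper = Mul]) (use assms in auto)
  then have "computable D inp (k + card {..<m} + m')
      (insert (\<lambda>p. \<Sum>j<Suc m'. ?z j p) (X \<union> ?z ` {..<m}))"
    by (rule computable_sum) (auto simp: m)
  then show ?thesis
    by (rule computable_mono) (auto simp: m)
qed

lemma computable_family_inner_product:
  fixes x y :: "nat \<Rightarrow> nat \<Rightarrow> 'p \<Rightarrow> real"
  assumes "computable D inp k X" "m \<ge> 1"
    and "\<And>i j. i < N \<Longrightarrow> j < m \<Longrightarrow> x i j \<in> X" "\<And>i j. i < N \<Longrightarrow> j < m \<Longrightarrow> y i j \<in> X"
  shows "computable D inp (k + N * (2 * m - 1)) (X \<union> (\<lambda>i p. \<Sum>j<m. x i j p * y i j p) ` {..<N})"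
proof -
  have "computable D inp (k + card {..<N} * (2 * m - 1))
      (X \<union> (\<lambda>i p. \<Sum>j<m. x i j p * y i j p) ` {..<N})"
    using _ assms(1)
  proof (rule computable_family)
    fix i k' Y assume "i \<in> {..<N}" "X \<subseteq> Y" "computable D inp k' Y"
    then show "computable D inp (k' + (2 * m - 1)) (insert (\<lambda>p. \<Sum>j<m. x i j p * y i j p) Y)"
      using assms(2-4) by (intro computable_inner_product) auto
  qed simp
  then show ?thesis by simp
qed

section \<open>Operation counts for rank one corrections\<close>

text \<open>The factor \<open>a - 1\<close> is applied to a vector and not to the outer product: one
  subtraction and \<open>N\<close> multiplications instead of \<open>N ^ 2\<close>.\<close>

lemma computable_shifted_scaling:
  assumes "computable D inp k X" "a \<in> X" "\<And>i. i < N \<Longrightarrow> u i \<in> X"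
  shows "computable D inp (k + 1 + N) (X \<union> (\<lambda>i p. (a p - 1) * u i p) ` {..<N})"
proof -
  let ?s = "\<lambda>p. a p - 1"
  have "computable D inp (Suc k) (insert ?s (insert (\<lambda>_. 1) X))"
    by (rule computable_op[where oper = Sub, OF computable_const, OF assms(1)])
      (use assms in auto)
  then have "computable D inp (Suc k + card {..<N})
      (insert ?s (insert (\<lambda>_. 1) X) \<union> (\<lambda>i p. ?s p * u i p) ` {..<N})"
    by (rule computable_family_op[where oper = Mul]) (use assms in auto)
  then show ?thesis
    by (rule computable_mono) auto
qed

text \<open>\<open>N ^ 2\<close> multiplications form the outer product and \<open>N ^ 2\<close>
  additions add it.\<close>

lemma computable_add_rank_one:
  assumes "computable D inp k X" "\<And>i j. i < N \<Longrightarrow> j < N \<Longrightarrow> m i j \<in> X"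
    and "\<And>i. i < N \<Longrightarrow> u i \<in> X" "\<And>j. j < N \<Longrightarrow> w j \<in> X"
  shows "computable D inp (k + 2 * N ^ 2)
    (X \<union> (\<lambda>(i, j) p. m i j p + u i p * w j p) ` ({..<N} \<times> {..<N}))"
proof -
  let ?I = "{..<N} \<times> {..<N}"
  define z where "z = (\<lambda>ij p. u (fst ij) p * w (snd ij) p)"
  have "computable D inp (k + card ?I) (X \<union> z ` ?I)"
    by (rule computable_family_op[where oper = Mul and x = "\<lambda>ij. u (fst ij)"
        and y = "\<lambda>ij. w (snd ij)"]) (use assms in \<open>auto simp: z_def\<close>)
  then have "computable D inp (k + card ?I + card ?I)
      ((X \<union> z ` ?I) \<union> (\<lambda>(i, j) p. m i j p + u i p * w j p) ` ?I)"
    by (rule computable_family_op[where oper = Add and x = "\<lambda>ij. m (fst ij) (snd ij)" and y = z])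
      (use assms in \<open>auto simp: z_def\<close>)
  then show ?thesis
    by (rule computable_mono) (auto simp: power2_eq_square)
qed

text \<open>The summands are the subtraction \<open>a - 1\<close>, the scaling of one vector,
  \<open>N\<close> inner products and the rank one addition. The \<open>N\<close> multiplications of
  the scaling are offset because each inner product of length \<open>N\<close> needs one addition
  fewer than multiplications.\<close>

lemma rank_one_cost: "1 + N + N * (2 * N - 1) + 2 * N ^ 2 \<le> 4 * N ^ 2 + (1::nat)"
  by (cases N) (auto simp: power2_eq_square algebra_simps)

text \<open>Bracketing the correction as \<open>(m u) ((a - 1) w)\<close> leaves only a
  matrix-vector product and an outer product.\<close>

lemma computable_mat_right:
  assumes "computable D inp 0 X" "N \<ge> 1" "\<And>i j. i < N \<Longrightarrow> j < N \<Longrightarrow> m i j \<in> X"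
    and "\<And>i. i < N \<Longrightarrow> u i \<in> X" "\<And>j. j < N \<Longrightarrow> w j \<in> X" "a \<in> X"
  shows "computable D inp (4 * N ^ 2 + 1)
    ((\<lambda>(i, j) p. m i j p + (\<Sum>k<N. m i k p * u k p) * ((a p - 1) * w j p)) ` ({..<N} \<times> {..<N}))"
proof -
  let ?w = "\<lambda>j p. (a p - 1) * w j p" and ?e = "\<lambda>i p. \<Sum>k<N. m i k p * u k p"
  let ?X1 = "X \<union> ?w ` {..<N}"
  have "computable D inp (0 + 1 + N) ?X1"
    using assms by (intro computable_shifted_scaling) auto
  then have "computable D inp (0 + 1 + N + N * (2 * N - 1)) (?X1 \<union> ?e ` {..<N})"
    by (rule computable_family_inner_product) (use assms in auto)
  then have "computable D inp (0 + 1 + N + N * (2 * N - 1) + 2 * N ^ 2)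
      ((?X1 \<union> ?e ` {..<N}) \<union> (\<lambda>(i, j) p. m i j p + ?e i p * ?w j p) ` ({..<N} \<times> {..<N}))"
    by (rule computable_add_rank_one) (use assms in auto)
  then show ?thesis
    by (rule computable_mono) (use rank_one_cost[of N] in auto)
qed

text \<open>Mirror image of \<open>computable_mat_right\<close>: here the column is scaled and the
  row is multiplied by the matrix.\<close>

lemma computable_mat_left:
  assumes "computable D inp 0 X" "N \<ge> 1" "\<And>i j. i < N \<Longrightarrow> j < N \<Longrightarrow> m i j \<in> X"
    and "\<And>i. i < N \<Longrightarrow> u i \<in> X" "\<And>j. j < N \<Longrightarrow> w j \<in> X" "a \<in> X"
  shows "computable D inp (4 * N ^ 2 + 1)
    ((\<lambda>(i, j) p. m i j p + ((a p - 1) * u i p) * (\<Sum>k<N. w k p * m k j p)) ` ({..<N} \<times> {..<N}))"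
proof -
  let ?u = "\<lambda>i p. (a p - 1) * u i p" and ?e = "\<lambda>j p. \<Sum>k<N. w k p * m k j p"
  let ?X1 = "X \<union> ?u ` {..<N}"
  have "computable D inp (0 + 1 + N) ?X1"
    using assms by (intro computable_shifted_scaling) auto
  then have "computable D inp (0 + 1 + N + N * (2 * N - 1)) (?X1 \<union> ?e ` {..<N})"
    by (rule computable_family_inner_product) (use assms in auto)
  then have "computable D inp (0 + 1 + N + N * (2 * N - 1) + 2 * N ^ 2)
      ((?X1 \<union> ?e ` {..<N}) \<union> (\<lambda>(i, j) p. m i j p + ?u i p * ?e j p) ` ({..<N} \<times> {..<N}))"
    by (rule computable_add_rank_one) (use assms in auto)
  then show ?thesis
    by (rule computable_mono) (use rank_one_cost[of N] in auto)
qed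

text \<open>The scalar \<open>a - 1\<close> times the inner product is formed before it meets
  \<open>u\<close>. The count is \<open>1 + (2 * N - 1) + 1 + N + N\<close>.\<close>

lemma computable_vec:
  assumes "computable D inp 0 X" "N \<ge> 1" "\<And>i. i < N \<Longrightarrow> v i \<in> X"
    and "\<And>i. i < N \<Longrightarrow> u i \<in> X" "\<And>j. j < N \<Longrightarrow> w j \<in> X" "a \<in> X"
  shows "computable D inp (4 * N + 1)
    ((\<lambda>i p. v i p + (a p - 1) * (\<Sum>k<N. w k p * v k p) * u i p) ` {..<N})"
proof -
  let ?d = "\<lambda>p. \<Sum>k<N. w k p * v k p" and ?s = "\<lambda>p. a p - 1"
  let ?e = "\<lambda>i p. ?s p * ?d p * u i p"
  have "computable D inp (Suc 0) (insert ?s (insert (\<lambda>_. 1) X))" (is "computable _ _ _ ?X1")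
    by (rule computable_op[where oper = Sub, OF computable_const, OF assms(1)])
      (use assms in auto)
  then have "computable D inp (Suc 0 + (2 * N - 1)) (insert ?d ?X1)"
    by (rule computable_inner_product) (use assms in auto)
  then have "computable D inp (Suc (Suc 0 + (2 * N - 1)))
      (insert (\<lambda>p. ?s p * ?d p) (insert ?d ?X1))" (is "computable _ _ _ ?X3")
    by (rule computable_op[where oper = Mul and x = ?s and y = ?d]) auto
  then have "computable D inp (Suc (Suc 0 + (2 * N - 1)) + card {..<N}) (?X3 \<union> ?e ` {..<N})"
    by (rule computable_family_op[where oper = Mul and x = "\<lambda>_ p. ?s p * ?d p" and y = u])
      (use assms in auto)
  then have "computable D inp (Suc (Suc 0 + (2 * N - 1)) + card {..<N} + card {..<N})
      ((?X3 \<union> ?e ` {..<N}) \<union> (\<lambda>i p. v i p + ?e i p) ` {..<N})"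
    by (rule computable_family_op[where oper = Add and x = v and y = ?e]) (use assms in auto)
  then show ?thesis
    by (rule computable_mono) (use assms(2) in auto)
qed

subsection \<open>Rank one updates of the identity matrix\<close>

lemma col_times_row_carrier: "col_times_row N u w \<in> carrier_mat N N"
  unfolding col_times_row_def
  by (rule mult_carrier_mat[of _ N 1]) (auto simp: mat_of_cols_def mat_of_rows_def)

lemma index_col_times_row:
  assumes "i < N" "j < N"
  shows "col_times_row N u w $$ (i, j) = u $ i * w $ j"
  using assms by (simp add: col_times_row_def scalar_prod_def mat_of_cols_def mat_of_rows_def)

text \<open>When the row \<open>w\<close> times the column \<open>u\<close> is 1, \<open>a\<close>
  is the eigenvalue on \<open>u\<close>; hence \<open>a\<close> and not \<open>a - 1\<close> is the
  parameter.\<close>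

definition rank_one_update :: "nat \<Rightarrow> real vec \<Rightarrow> real \<Rightarrow> real vec \<Rightarrow> real mat" where
  "rank_one_update N u a w = 1\<^sub>m N + (a - 1) \<cdot>\<^sub>m col_times_row N u w"

lemma rank_one_update_carrier: "rank_one_update N u a w \<in> carrier_mat N N"
  unfolding rank_one_update_def
  by (intro add_carrier_mat smult_carrier_mat col_times_row_carrier)

lemma dim_rank_one_update [simp]:
  "dim_row (rank_one_update N u a w) = N" "dim_col (rank_one_update N u a w) = N"
  using rank_one_update_carrier[of N u a w] by auto

lemma rank_one_update_index:
  "i < N \<Longrightarrow> j < N \<Longrightarrow>
    rank_one_update N u a w $$ (i, j) = (if i = j then 1 else 0) + (a - 1) * (u $ i * w $ j)"
  using col_times_row_carrier[of N u w] by (auto simp: rank_one_update_def index_col_times_row)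

text \<open>The bracketing on the right is that of the values in \<open>computable_vec\<close>; the
  two matrix versions below match \<open>computable_mat_left\<close> and
  \<open>computable_mat_right\<close> in the same way.\<close>

lemma rank_one_update_mult_vec:
  assumes "v \<in> carrier_vec N" "i < N"
  shows "(rank_one_update N u a w *\<^sub>v v) $ i =
    v $ i + (a - 1) * (\<Sum>k<N. w $ k * v $ k) * u $ i" (is "(?R *\<^sub>v v) $ i = _")
proof -
  have "(?R *\<^sub>v v) $ i = (\<Sum>k<N. ?R $$ (i, k) * v $ k)"
    using assms
    by (auto simp: scalar_prod_def lessThan_atLeast0 intro!: sum.cong)
  also have "\<dots> = (\<Sum>k<N. (if i = k then v $ k else 0) + (a - 1) * (w $ k * v $ k) * u $ i)"
    by (rule sum.cong) (use assms in \<open>auto simp: rank_one_update_index algebra_simps\<close>)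
  finally show ?thesis
    using assms(2) by (simp add: sum.distrib sum_distrib_left sum_distrib_right)
qed

text \<open>Column \<open>j\<close> of the product is the update applied to column \<open>j\<close>
  of \<open>M\<close>.\<close>

lemma rank_one_update_mult_mat:
  assumes M: "M \<in> carrier_mat N N" and "i < N" "j < N"
  shows "(rank_one_update N u a w * M) $$ (i, j) =
    M $$ (i, j) + (a - 1) * u $ i * (\<Sum>k<N. w $ k * M $$ (k, j))" (is "(?R * M) $$ _ = _")
proof -
  have "(?R * M) $$ (i, j) = (?R *\<^sub>v col M j) $ i"
    using assms by auto
  also have "\<dots> = M $$ (i, j) + (a - 1) * (\<Sum>k<N. w $ k * M $$ (k, j)) * u $ i"
    by (subst rank_one_update_mult_vec) (use assms in auto)
  finally show ?thesis by simp
qed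

lemma mat_mult_rank_one_update:
  assumes M: "M \<in> carrier_mat N N" and "i < N" "j < N"
  shows "(M * rank_one_update N u a w) $$ (i, j) =
    M $$ (i, j) + (\<Sum>k<N. M $$ (i, k) * u $ k) * ((a - 1) * w $ j)" (is "(M * ?R) $$ _ = _")
proof -
  have "(M * ?R) $$ (i, j) = (\<Sum>k<N. M $$ (i, k) * ?R $$ (k, j))"
    using assms
    by (auto simp: scalar_prod_def lessThan_atLeast0 intro!: sum.cong)
  also have "\<dots> = (\<Sum>k<N. (if k = j then M $$ (i, k) else 0) + M $$ (i, k) * u $ k * ((a - 1) * w $ j))"
    by (rule sum.cong) (use assms in \<open>auto simp: rank_one_update_index algebra_simps\<close>)
  finally show ?thesis
    using assms(3) by (simp add: sum.distrib sum_distrib_right)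
qed

text \<open>One side suffices: the inverse has the same form, so replacing \<open>a\<close> by
  \<open>inverse a\<close> gives the other side.\<close>

lemma rank_one_update_inverse:
  assumes "a \<noteq> 0" "(\<Sum>k<N. w $ k * u $ k) = 1"
  shows "rank_one_update N u a w *
    rank_one_update N u (inverse a) w = 1\<^sub>m N" (is "?R * ?Q = _")
proof (rule eq_matI)
  fix i j assume "i < dim_row (1\<^sub>m N :: real mat)" "j < dim_col (1\<^sub>m N :: real mat)"
  then have ij: "i < N" "j < N" by auto
  let ?b = "inverse a - 1"
  \<comment> \<open>The normalisation makes \<open>w\<close> a left eigenvector of \<open>?Q\<close>
    with eigenvalue \<open>inverse a\<close>, which evaluates the correction contributed by
    \<open>?R\<close>.\<close>
  have "(\<Sum>k<N. w $ k * ?Q $$ (k, j)) =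
      (\<Sum>k<N. (if k = j then w $ k else 0) + w $ k * u $ k * (?b * w $ j))"
    by (rule sum.cong) (use ij in \<open>auto simp: rank_one_update_index algebra_simps\<close>)
  also have "\<dots> = w $ j + ?b * w $ j"
    using ij assms(2) by (simp add: sum.distrib flip: sum_distrib_right)
  finally have "(?R * ?Q) $$ (i, j) =
      ?Q $$ (i, j) + (a - 1) * u $ i * (w $ j + ?b * w $ j)"
    using ij by (simp only: rank_one_update_mult_mat[OF rank_one_update_carrier])
  also have "\<dots> = (1\<^sub>m N) $$ (i, j)"
    using ij assms(1) by (simp add: rank_one_update_index field_simps)
  finally show "(?R * ?Q) $$ (i, j) = (1\<^sub>m N) $$ (i, j)" .
qed simp_all

section \<open>Row-major encoding of matrices\<close>

lemma nth_mat_data: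
  assumes "M \<in> carrier_mat N N" "i < N" "j < N"
  shows "mat_data M ! (i * N + j) = M $$ (i, j)"
proof -
  \<comment> \<open>The number of rows \<open>r\<close> is kept apart from the row length
    \<open>m\<close>, so that the induction can add one row at a time.\<close>
  have "concat (map (\<lambda>i. map (f i) [0..<m]) [0..<r]) ! (i * m + j) = f i j"
    if "i < r" "j < m" for f :: "nat \<Rightarrow> nat \<Rightarrow> real" and r m
    using that
  proof (induction r)
    case (Suc r)
    have len: "length (concat (map (\<lambda>i. map (f i) [0..<m]) [0..<r])) = r * m"
      by (induction r) auto
    show ?case
    proof (cases "i = r")
      case True
      then show ?thesis using Suc.prems len by (simp add: nth_append)
    next
      case False
      then have "i < r" using Suc.prems by simp
      then have "i * m + m \<le> r * m" by (metis Suc_leI add.commute mult_Suc mult_le_mono1)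
      then have "i * m + j < r * m" using Suc.prems by linarith
      then show ?thesis using Suc.IH \<open>i < r\<close> Suc.prems len by (simp add: nth_append)
    qed
  qed simp
  then show ?thesis
    using assms by (simp add: mat_data_def mat_to_list_def)
qed

lemma length_mat_data: "M \<in> carrier_mat m N \<Longrightarrow> length (mat_data M) = m * N"
  by (simp add: mat_data_def mat_to_list_def length_concat o_def sum_list_triv)

lemma mat_data_eq:
  "M \<in> carrier_mat m N \<Longrightarrow> mat_data M = concat (map (\<lambda>i. map (\<lambda>j. M $$ (i, j)) [0..<N]) [0..<m])"
  by (simp add: mat_data_def mat_to_list_def)

subsection \<open>Polynomials and the exponential of a rank one endomorphism\<close>

lemma lookup_scaleR [simp]:
  "Poly_Mapping.lookup (r *\<^sub>R p) k = r *\<^sub>R Poly_Mapping.lookup p k"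
  by (cases "Poly_Mapping.lookup p k = 0")
    (simp_all add: scaleR_poly_mapping_def Poly_Mapping.map.rep_eq)

definition exponents :: "nat \<Rightarrow> nat \<Rightarrow> (nat \<Rightarrow>\<^sub>0 nat) set" where
  "exponents n d =
     {m. Poly_Mapping.keys m \<subseteq> {1..n} \<and> (\<Sum>i = 1..n. Poly_Mapping.lookup m i) \<le> d}"

lemma mem_polys_iff:
  "p \<in> polys n d \<longleftrightarrow> (\<forall>m. Poly_Mapping.lookup p m \<noteq> 0 \<longrightarrow> m \<in> exponents n d)"
  by (auto simp: polys_def exponents_def in_keys_iff)

lemma subspace_polys: "subspace (polys n d)"
proof (rule subspaceI)
  fix x y assume "x \<in> polys n d" "y \<in> polys n d"
  then show "x + y \<in> polys n d"
    unfolding mem_polys_iff lookup_add by (metis add.right_neutral)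
qed (auto simp: mem_polys_iff)

lemma single_mem_polys: "m \<in> exponents n d \<Longrightarrow> Poly_Mapping.single m r \<in> polys n d"
  by (auto simp: mem_polys_iff lookup_single when_def)

lemma zero_mem_exponents: "0 \<in> exponents n d"
  by (simp add: exponents_def)

text \<open>An exponent vector is extended by the slack \<open>d - |m|\<close> to a list with sum exactly \<open>d\<close>.\<close>

lemma card_exponents: "card (exponents n d) = (n + d) choose n"
proof -
  let ?L = "{l :: nat list. length l = Suc n \<and> sum_list l = d}"
  let ?f = "\<lambda>m. (d - (\<Sum>i = 1..n. Poly_Mapping.lookup m i)) # map (Poly_Mapping.lookup m) [1..<Suc n]"
  \<comment> \<open>Entry 0 of the list is the slack, so entry \<open>i\<close> is the exponent of
    variable \<open>i\<close>, counted from 1.\<close>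
  let ?h = "\<lambda>l i. if i \<in> {1..n} then l ! i else (0::nat)"
  let ?g = "\<lambda>l. Abs_poly_mapping (?h l)"
  have lookup_g: "Poly_Mapping.lookup (?g l) = ?h l" for l
    by (rule lookup_Abs_poly_mapping) (rule finite_subset[of _ "{1..n}"], auto)
  have sum_list_upt: "sum_list (map h [1..<Suc n]) = (\<Sum>i = 1..n. h i)" for h :: "nat \<Rightarrow> nat"
    by (simp only: sum_list_distinct_conv_sum_set[OF distinct_upt] set_upt
      atLeastLessThanSuc_atLeastAtMost)
  have "bij_betw ?f (exponents n d) ?L"
  proof (rule bij_betw_byWitness[where f' = ?g])
    show "\<forall>m\<in>exponents n d. ?g (?f m) = m"
    proof
      fix m assume "m \<in> exponents n d"
      then have "i \<notin> {1..n} \<Longrightarrow> Poly_Mapping.lookup m i = 0" for i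
        by (auto simp: exponents_def in_keys_iff)
      then show "?g (?f m) = m"
        by (intro poly_mapping_eqI, unfold lookup_g)
          (auto simp: nth_Cons nth_append less_Suc_eq_le split: nat.split simp del: upt_Suc)
    qed
    show "\<forall>l\<in>?L. ?f (?g l) = l"
    proof
      fix l assume "l \<in> ?L"
      then obtain x xs where l: "l = x # xs" "length xs = n" "x + sum_list xs = d"
        by (cases l) auto
      have xs: "map (?h l) [1..<Suc n] = xs"
        by (rule nth_equalityI) (auto simp: l simp del: upt_Suc)
      moreover have "(\<Sum>i = 1..n. ?h l i) = sum_list xs"
        using sum_list_upt[of "?h l"] xs by simp
      ultimately show "?f (?g l) = l"
        unfolding lookup_g using l by simp
    qed
    show "?f ` exponents n d \<subseteq> ?L"
      by (auto simp: exponents_def sum_list_upt simp del: upt_Suc One_nat_def)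
    show "?g ` ?L \<subseteq> exponents n d"
    proof
      fix m assume "m \<in> ?g ` ?L"
      then obtain l where "l \<in> ?L" and m: "m = ?g l" by blast
      then obtain x xs where l: "l = x # xs" "length xs = n" "x + sum_list xs = d"
        by (cases l) auto
      have xs: "map (?h l) [1..<Suc n] = xs"
        by (rule nth_equalityI) (auto simp: l simp del: upt_Suc)
      have "(\<Sum>i = 1..n. ?h l i) = sum_list xs"
        using sum_list_upt[of "?h l"] xs by simp
      then show "m \<in> exponents n d"
        unfolding m exponents_def using l(3)
        by (auto simp: lookup_g in_keys_iff split: if_splits)
    qed
  qed
  then have "card (exponents n d) = card ?L"
    by (rule bij_betw_same_card)
  \<comment> \<open>Stars and bars counts \<open>(n + d) choose d\<close> lists; the symmetry of the
    binomial coefficient gives the stated form.\<close>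
  then show ?thesis
    using binomial_symmetric[of n "n + d"] by (simp add: card_length_sum_list add.commute)
qed

text \<open>Infinite sets have \<open>card\<close> 0, whereas the binomial coefficient is
  positive.\<close>

lemma finite_exponents: "finite (exponents n d)"
  by (rule card_ge_0_finite) (simp add: card_exponents)

text \<open>The monomials form a basis: the coefficient of a combination at an exponent recovers its
  scalar, which gives both spanning and independence.\<close>

lemma dim_polys: "dim (polys n d) = (n + d) choose n"
proof -
  let ?E = "exponents n d" and ?s = "\<lambda>m. Poly_Mapping.single m (1::real)"
  have inj: "inj_on ?s ?E"
    by (rule inj_onI) (metis lookup_single_eq lookup_single_not_eq zero_neq_one)
  have lookup_comb: "Poly_Mapping.lookup (\<Sum>m\<in>?E. c m *\<^sub>R ?s m) k = (if k \<in> ?E then c k else 0)"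
    for c k
    by (simp add: lookup_sum lookup_single when_def finite_exponents if_distrib cong: if_cong)
  have "card (?s ` ?E) = dim (polys n d)"
  proof (rule real_vector.basis_card_eq_dim)
    show "?s ` ?E \<subseteq> polys n d"
      by (auto intro: single_mem_polys)
    show "polys n d \<subseteq> span (?s ` ?E)"
    proof
      fix p assume "p \<in> polys n d"
      then have "p = (\<Sum>m\<in>?E. Poly_Mapping.lookup p m *\<^sub>R ?s m)"
        by (intro poly_mapping_eqI) (auto simp: lookup_comb mem_polys_iff)
      also have "\<dots> \<in> span (?s ` ?E)"
        by (intro span_sum span_scale span_base) auto
      finally show "p \<in> span (?s ` ?E)" .
    qed
    show "independent (?s ` ?E)"
    proof (rule real_vector.independent_if_scalars_zero)
      fix c x assume "(\<Sum>b\<in>?s ` ?E. c b *\<^sub>R b) = 0" "x \<in> ?s ` ?E"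
      then obtain m where "m \<in> ?E" "x = ?s m" "(\<Sum>m\<in>?E. c (?s m) *\<^sub>R ?s m) = 0"
        by (auto simp: sum.reindex[OF inj])
      then show "c x = 0"
        using lookup_comb[of "\<lambda>m. c (?s m)" m] by simp
    qed (simp add: finite_exponents)
  qed
  then show ?thesis
    by (simp add: card_image[OF inj] card_exponents)
qed

section \<open>Coefficientwise convergence and the exponential series\<close>

text \<open>Open sets of \<open>poly_top\<close> are preimages of open sets of coefficient
  functions. These carry the product topology, whose limits are pointwise.\<close>

lemma limitin_poly_top_iff:
  assumes "\<And>k. g k \<in> polys n d"
  shows "limitin (poly_top n d) g q F \<longleftrightarrow> q \<in> polys n d \<and>
    (\<forall>m. ((\<lambda>k. Poly_Mapping.lookup (g k) m) \<longlongrightarrow> Poly_Mapping.lookup q m) F)"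
proof -
  have "limitin (poly_top n d) g q F \<longleftrightarrow> q \<in> polys n d \<and>
      limitin euclidean (\<lambda>k. Poly_Mapping.lookup (g k)) (Poly_Mapping.lookup q) F"
  proof -
    have "openin (poly_top n d) U \<longleftrightarrow> (\<exists>W. open W \<and> U = Poly_Mapping.lookup -` W \<inter> polys n d)" for U
      unfolding poly_top_def openin_pullback_topology by simp
    moreover have "topspace (poly_top n d) = polys n d"
      by (simp add: poly_top_def topspace_pullback_topology)
    ultimately have "limitin (poly_top n d) g q F \<longleftrightarrow> q \<in> polys n d \<and>
        (\<forall>W. open W \<and> q \<in> Poly_Mapping.lookup -` W \<inter> polys n d \<longrightarrow>
          (\<forall>\<^sub>F k in F. g k \<in> Poly_Mapping.lookup -` W \<inter> polys n d))"
      unfolding limitin_def by (simp only:) blast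
    then show ?thesis
      using assms unfolding limitin_def by auto
  qed
  then show ?thesis
    by (simp only: euclidean_product_topology[symmetric] limitin_componentwise) simp
qed

text \<open>The definite description needs uniqueness: real limits are unique in each coefficient,
  and the coefficients determine the polynomial.\<close>

lemma endo_exp_eqI:
  assumes "\<And>k. (A ^^ k) p \<in> polys n d" "q \<in> polys n d"
    and "\<And>m. (\<lambda>k. 1 / fact k * Poly_Mapping.lookup ((A ^^ k) p) m) sums Poly_Mapping.lookup q m"
  shows "endo_exp n d A p = q"
proof -
  have *: "(\<Sum>k<K. (1 / fact k) *\<^sub>R (A ^^ k) p) \<in> polys n d" for K
    by (intro subspace_sum subspace_scale subspace_polys assms)
  note limit_iff = limitin_poly_top_iff[of "\<lambda>K. \<Sum>k<K. (1 / fact k) *\<^sub>R (A ^^ k) p", OF *]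
  have lim: "(\<lambda>K. Poly_Mapping.lookup (\<Sum>k<K. (1 / fact k) *\<^sub>R (A ^^ k) p) m)
      \<longlonglongrightarrow> Poly_Mapping.lookup q m" for m
    using assms(3)[of m] by (simp add: sums_def lookup_sum)
  show ?thesis
    unfolding endo_exp_def
  proof (rule the_equality)
    show "limitin (poly_top n d) (\<lambda>K. \<Sum>k<K. (1 / fact k) *\<^sub>R (A ^^ k) p) q sequentially"
      using lim assms(2) by (simp only: limit_iff simp_thms)
    fix q' assume "limitin (poly_top n d) (\<lambda>K. \<Sum>k<K. (1 / fact k) *\<^sub>R (A ^^ k) p) q' sequentially"
    then have "\<And>m. (\<lambda>K. Poly_Mapping.lookup (\<Sum>k<K. (1 / fact k) *\<^sub>R (A ^^ k) p) m)
        \<longlonglongrightarrow> Poly_Mapping.lookup q' m"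
      by (simp only: limit_iff simp_thms)
    with lim show "q' = q"
      by (intro poly_mapping_eqI) (blast intro: LIMSEQ_unique)
  qed
qed

lemma linear_functional_onD:
  assumes "linear_functional_on V l"
  shows "p \<in> V \<Longrightarrow> q \<in> V \<Longrightarrow> l (p + q) = l p + l q" "p \<in> V \<Longrightarrow> l (r *\<^sub>R p) = r * l p"
  using assms by (auto simp: linear_functional_on_def)

text \<open>As \<open>l\<close> is known to be linear only on \<open>V\<close>, the induction has to
  check that each partial sum stays in \<open>V\<close>.\<close>

lemma linear_functional_on_sum:
  assumes "linear_functional_on V l" "subspace V" "finite I" "\<And>i. i \<in> I \<Longrightarrow> v i \<in> V"
  shows "l (\<Sum>i\<in>I. c i *\<^sub>R v i) = (\<Sum>i\<in>I. c i * l (v i))"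
  using assms(3,4)
proof (induction I)
  case empty
  show ?case
    using linear_functional_onD(2)[OF assms(1) subspace_0[OF assms(2)], of 0] by simp
next
  case (insert i I)
  have "(\<Sum>i\<in>I. c i *\<^sub>R v i) \<in> V"
    by (intro subspace_sum subspace_scale assms insert) auto
  then show ?case
    using insert linear_functional_onD[OF assms(1)]
    by (simp add: subspace_scale[OF assms(2)])
qed

lemma endo_exp_rank_one:
  assumes l: "linear_functional_on (polys n d) l" and f: "f \<in> polys n d" and p: "p \<in> polys n d"
    and "l f \<noteq> 0"
  shows "endo_exp n d (\<lambda>p. \<tau> *\<^sub>R (l p *\<^sub>R f)) p =
    p + ((exp (\<tau> * l f) - 1) * l p) *\<^sub>R (inverse (l f) *\<^sub>R f)"
proof -
  let ?A = "\<lambda>p. \<tau> *\<^sub>R (l p *\<^sub>R f)"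
  \<comment> \<open>The formula starts at the first power: at exponent 0 it would give a multiple of
    \<open>f\<close> in place of \<open>p\<close>.\<close>
  have pow: "(?A ^^ Suc k) p = ((\<tau> * l f) ^ Suc k * (l p / l f)) *\<^sub>R f" for k
  proof (induction k)
    case 0
    then show ?case using \<open>l f \<noteq> 0\<close> by simp
  next
    case (Suc k)
    have "(?A ^^ Suc (Suc k)) p = ?A ((?A ^^ Suc k) p)" by simp
    also have "\<dots> = ((\<tau> * l f) ^ Suc (Suc k) * (l p / l f)) *\<^sub>R f"
      unfolding Suc linear_functional_onD(2)[OF l f] by (simp add: algebra_simps)
    finally show ?case .
  qed
  show ?thesis
  proof (rule endo_exp_eqI)
    show "(?A ^^ k) p \<in> polys n d" for k
      using p f by (cases k) (auto simp only: pow funpow_0 intro!: subspace_scale subspace_polys)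
    show "p + ((exp (\<tau> * l f) - 1) * l p) *\<^sub>R (inverse (l f) *\<^sub>R f) \<in> polys n d"
      by (intro subspace_add subspace_scale subspace_polys p f)
    fix m
    let ?c = "l p / l f * Poly_Mapping.lookup f m"
    \<comment> \<open>This is the real exponential series scaled by \<open>?c\<close>, with a
      correction at \<open>k = 0\<close>, where the true term is the coefficient of \<open>p\<close>
      and not \<open>?c\<close>.\<close>
    have "(\<lambda>k. (\<tau> * l f) ^ k /\<^sub>R fact k * ?c + (if k = 0 then Poly_Mapping.lookup p m - ?c else 0))
        sums (exp (\<tau> * l f) * ?c + (Poly_Mapping.lookup p m - ?c))"
      using sums_single[of 0 "\<lambda>_. Poly_Mapping.lookup p m - ?c"]
      by (intro sums_add sums_mult2 exp_converges) simp_all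
    moreover have "1 / fact k * Poly_Mapping.lookup ((?A ^^ k) p) m =
        (\<tau> * l f) ^ k /\<^sub>R fact k * ?c + (if k = 0 then Poly_Mapping.lookup p m - ?c else 0)" for k
      by (cases k) (auto simp only: pow funpow_0 lookup_scaleR, auto simp: field_simps)
    moreover have "exp (\<tau> * l f) * ?c + (Poly_Mapping.lookup p m - ?c) = Poly_Mapping.lookup
        (p + ((exp (\<tau> * l f) - 1) * l p) *\<^sub>R (inverse (l f) *\<^sub>R f)) m"
      unfolding lookup_add lookup_scaleR by (simp add: divide_inverse algebra_simps)
    ultimately show "(\<lambda>k. 1 / fact k * Poly_Mapping.lookup ((?A ^^ k) p) m) sums Poly_Mapping.lookup
        (p + ((exp (\<tau> * l f) - 1) * l p) *\<^sub>R (inverse (l f) *\<^sub>R f)) m"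
      by simp
  qed
qed

section \<open>Positivity of the functional at interior points\<close>

text \<open>Constants lie in \<open>polys n d\<close> for all \<open>n\<close> and \<open>d\<close>,
  and these tend to 0 coefficientwise. The sign of \<open>r\<close> is free, so that opposite
  constants can be placed in the same neighbourhood.\<close>

lemma small_const_mem_nhd_zero:
  assumes "openin (poly_top n d) U" "0 \<in> U"
  shows "\<forall>\<^sub>F k in sequentially. Poly_Mapping.single 0 (r / real (Suc k)) \<in> U"
proof -
  have "limitin (poly_top n d) (\<lambda>k. Poly_Mapping.single 0 (r / real (Suc k))) 0 sequentially"
    unfolding limitin_poly_top_iff[OF single_mem_polys[OF zero_mem_exponents]]
  proof (intro conjI allI)
    show "0 \<in> polys n d" by (rule subspace_0[OF subspace_polys])
    show "(\<lambda>k. Poly_Mapping.lookup (Poly_Mapping.single 0 (r / real (Suc k))) m)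
        \<longlonglongrightarrow> Poly_Mapping.lookup 0 m" for m :: "nat \<Rightarrow>\<^sub>0 nat"
      using LIMSEQ_Suc[OF lim_const_over_n[of r]] by (cases "m = 0") (auto simp: lookup_single)
  qed
  with assms show ?thesis
    by (auto simp: limitin_def)
qed

lemma interior_point_pos:
  assumes C: "C \<subseteq> polys n d" and l: "linear_functional_on (polys n d) l"
    and pos: "\<And>p. p \<in> C - {0} \<Longrightarrow> l p > 0" and f: "f \<in> poly_top n d interior_of C"
  shows "f \<in> polys n d" "l f > 0"
proof -
  obtain U where U: "openin (poly_top n d) U" "f \<in> U" "U \<subseteq> C"
    using f by (auto simp: interior_of_def)
  then show "f \<in> polys n d" using C by auto
  have "f \<noteq> 0"
  proof
    assume "f = 0"
    \<comment> \<open>Both memberships hold eventually, hence at a common index, where the two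
      constants are exact opposites.\<close>
    with U have "\<forall>\<^sub>F k in sequentially. Poly_Mapping.single 0 (1 / real (Suc k)) \<in> U \<and>
        Poly_Mapping.single 0 (- 1 / real (Suc k)) \<in> U"
      by (intro eventually_conj small_const_mem_nhd_zero) auto
    then obtain k where k: "Poly_Mapping.single 0 (1 / real (Suc k)) \<in> U"
        "Poly_Mapping.single 0 (- 1 / real (Suc k)) \<in> U"
      by (auto simp: eventually_sequentially)
    let ?p = "Poly_Mapping.single (0 :: nat \<Rightarrow>\<^sub>0 nat) (1 / real (Suc k))"
    have neg: "Poly_Mapping.single 0 (- 1 / real (Suc k)) = (- 1) *\<^sub>R ?p"
      by (intro poly_mapping_eqI) (auto simp: lookup_single when_def)
    have "?p \<noteq> 0"
      by (metis divide_eq_0_iff lookup_single_eq lookup_zero of_nat_eq_0_iff old.nat.distinct(1) zero_neq_one)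
    then have "?p \<in> C - {0}" "(- 1) *\<^sub>R ?p \<in> C - {0}"
      using k(1) k(2)[unfolded neg] U(3) by auto
    then have "l ?p > 0" "l ((- 1) *\<^sub>R ?p) > 0"
      by (blast intro: pos)+
    then show False
      using linear_functional_onD(2)[OF l, of ?p "- 1"] k(1) U(3) C by auto
  qed
  then show "l f > 0" using pos U by auto
qed

subsection \<open>Coordinates and programs\<close>

lemma coord_vec_carrier [simp]: "coord_vec bs p \<in> carrier_vec (length bs)"
  by (simp add: coord_vec_def)

lemma functional_vec_carrier [simp]: "functional_vec bs l \<in> carrier_vec (length bs)"
  by (simp add: functional_vec_def)

lemma length_basis_eq_dim: "is_basis V bs \<Longrightarrow> length bs = dim V"
  unfolding is_basis_def using dim_eq_card_independent[of "set bs"]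
  by (metis distinct_card real_vector.dim_span)

lemma index_matrix_in:
  "i < length bs \<Longrightarrow> j < length bs \<Longrightarrow>
    matrix_in bs T $$ (i, j) = representation (set bs) (T (bs ! j)) (bs ! i)"
  by (simp add: matrix_in_def mat_of_cols_index coord_vec_def)

text \<open>Column \<open>j\<close> holds the coordinates of \<open>T (bs ! j)\<close>. By linearity
  of the representation, \<open>bs ! j\<close> contributes a unit vector and the correction
  contributes \<open>l (bs ! j)\<close>, entry \<open>j\<close> of the row, times the column of
  \<open>g\<close>.\<close>

lemma matrix_in_rank_one_update:
  assumes bs: "is_basis V bs" and g: "g \<in> V"
    and T: "\<And>p. p \<in> V \<Longrightarrow> T p = p + ((a - 1) * l p) *\<^sub>R g"
  shows "matrix_in bs T = rank_one_update (length bs) (coord_vec bs g) a (functional_vec bs l)"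
    (is "_ = ?R")
proof (rule eq_matI)
  show "dim_row (matrix_in bs T) = dim_row ?R" "dim_col (matrix_in bs T) = dim_col ?R"
    by (simp_all add: matrix_in_def)
  fix i j assume "i < dim_row ?R" "j < dim_col ?R"
  then have ij: "i < length bs" "j < length bs" by auto
  then have mem: "bs ! i \<in> set bs" "bs ! j \<in> set bs" by auto
  have bs': "distinct bs" "independent (set bs)" "span (set bs) = V"
    using bs by (auto simp: is_basis_def)
  have span: "bs ! j \<in> span (set bs)" "g \<in> span (set bs)"
    using mem g bs' by (auto intro: span_base)
  have "T (bs ! j) = bs ! j + ((a - 1) * l (bs ! j)) *\<^sub>R g"
    using T span(1) bs'(3) by simp
  then have "representation (set bs) (T (bs ! j)) (bs ! i) =
      representation (set bs) (bs ! j) (bs ! i) + (a - 1) * l (bs ! j) * representation (set bs) g (bs ! i)"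
    by (simp only: real_vector.representation_add[OF bs'(2) span_scale[OF span(2)] span(1)]
        real_vector.representation_scale[OF bs'(2) span(2)])
  \<comment> \<open>Distinctness of the list turns equality of basis elements into equality of
    positions.\<close>
  also have "representation (set bs) (bs ! j) (bs ! i) = (if i = j then 1 else 0)"
    using ij bs'(1) by (simp add: real_vector.representation_basis[OF bs'(2) mem(2)] nth_eq_iff_index_eq)
  finally show "matrix_in bs T $$ (i, j) = ?R $$ (i, j)"
    using ij by (simp add: rank_one_update_index index_matrix_in coord_vec_def functional_vec_def)
qed

text \<open>Expand \<open>p\<close> in the basis and apply \<open>l\<close> termwise. For the
  normalised \<open>f\<close> this gives the condition row times column equals 1.\<close>

lemma functional_vec_coord_vec:
  assumes bs: "is_basis V bs" and l: "linear_functional_on V l" and p: "p \<in> V"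
  shows "(\<Sum>k<length bs. functional_vec bs l $ k * coord_vec bs p $ k) = l p"
proof -
  have bs': "distinct bs" "independent (set bs)" "span (set bs) = V"
    using bs by (auto simp: is_basis_def)
  have "l p = l (\<Sum>b\<in>set bs. representation (set bs) p b *\<^sub>R b)"
    using real_vector.sum_representation_eq[of "set bs" p "set bs"] bs' p by simp
  also have "\<dots> = (\<Sum>b\<in>set bs. representation (set bs) p b * l b)"
    by (rule linear_functional_on_sum[OF l])
      (use bs' in \<open>auto simp: real_vector.subspace_span intro: span_base\<close>)
  also have "\<dots> = (\<Sum>k<length bs. representation (set bs) p (bs ! k) * l (bs ! k))"
    by (rule sum.reindex_bij_betw[symmetric, OF bij_betw_nth[OF bs'(1)]]) auto
  finally show ?thesis
    by (simp add: functional_vec_def coord_vec_def mult.commute)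
qed

section \<open>Memory layout of the inputs\<close>

text \<open>The prefix fills the cells below \<open>L\<close>, the column starts at
  \<open>L\<close>, the scalar sits at \<open>L + N\<close> and the row starts at
  \<open>L + N + 1\<close>. The prefix is a matrix or a vector in the two instances below.\<close>

lemma computable_triple_input:
  assumes "\<And>p. p \<in> D \<Longrightarrow> inp p = pre p @ triple_data (u p) (a p) (w p)"
    and "\<And>p. p \<in> D \<Longrightarrow> length (pre p) = L"
    and "\<And>p. p \<in> D \<Longrightarrow> u p \<in> carrier_vec N" "\<And>p. p \<in> D \<Longrightarrow> w p \<in> carrier_vec N"
    and "\<And>x. x \<in> X \<Longrightarrow> \<exists>i<L. \<forall>p\<in>D. pre p ! i = x p"
  shows "computable D inp 0
    (insert a (X \<union> (\<lambda>i p. u p $ i) ` {..<N} \<union> (\<lambda>i p. w p $ i) ` {..<N}))"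
proof (rule computable_input)
  have inp: "inp p = pre p @ triple_data (u p) (a p) (w p)" "length (pre p) = L"
      "dim_vec (u p) = N" "dim_vec (w p) = N" if "p \<in> D" for p
    using that assms(1-4) by auto
  show "length (inp p) = L + (2 * N + 1)" if "p \<in> D" for p
    using that by (simp add: inp triple_data_def)
  fix x assume "x \<in> insert a (X \<union> (\<lambda>i p. u p $ i) ` {..<N} \<union> (\<lambda>i p. w p $ i) ` {..<N})"
  then consider "x = a" | "x \<in> X" | i where "i < N" "x = (\<lambda>p. u p $ i)"
    | i where "i < N" "x = (\<lambda>p. w p $ i)"
    by auto
  then show "\<exists>i<L + (2 * N + 1). \<forall>p\<in>D. inp p ! i = x p"
  proof cases
    case 1
    then show ?thesis
      by (intro exI[of _ "L + N"]) (auto simp: inp triple_data_def nth_append)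
  next
    case 2
    then obtain i where "i < L" "\<forall>p\<in>D. pre p ! i = x p" using assms(5) by blast
    then show ?thesis
      by (intro exI[of _ i]) (auto simp: inp nth_append)
  next
    case 3
    then show ?thesis
      by (intro exI[of _ "L + i"]) (auto simp: inp triple_data_def nth_append)
  next
    case 4
    then show ?thesis
      by (intro exI[of _ "L + (N + Suc i)"]) (auto simp: inp triple_data_def nth_append)
  qed
qed

text \<open>The parameter is the tuple of matrix, column, scalar and row. The scalar is arbitrary,
  so one program serves both a matrix and its inverse.\<close>

lemma computable_mat_input:
  "computable (carrier_mat N N \<times> carrier_vec N \<times> UNIV \<times> carrier_vec N)
    (\<lambda>p. mat_data (fst p) @ triple_data (fst (snd p)) (fst (snd (snd p))) (snd (snd (snd p)))) 0
    (insert (\<lambda>p. fst (snd (snd p))) ((\<lambda>(i, j) p. fst p $$ (i, j)) ` ({..<N} \<times> {..<N}) \<union>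
      (\<lambda>i p. fst (snd p) $ i) ` {..<N} \<union> (\<lambda>i p. snd (snd (snd p)) $ i) ` {..<N}))"
proof (rule computable_triple_input[where L = "N * N" and pre = "\<lambda>p. mat_data (fst p)"])
  fix x :: "real mat \<times> real vec \<times> real \<times> real vec \<Rightarrow> real"
  assume "x \<in> (\<lambda>(i, j) p. fst p $$ (i, j)) ` ({..<N} \<times> {..<N})"
  then obtain i j where ij: "i < N" "j < N" and x: "x = (\<lambda>p. fst p $$ (i, j))"
    by auto
  \<comment> \<open>Row \<open>i\<close> ends within the matrix block, so position
    \<open>i * N + j\<close> lies inside the prefix.\<close>
  then have "Suc i * N \<le> N * N" by (intro mult_le_mono1) simp
  with ij have "i * N + j < N * N" by simp
  then show "\<exists>k<N * N. \<forall>p\<in>carrier_mat N N \<times> carrier_vec N \<times> UNIV \<times> carrier_vec N.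
      mat_data (fst p) ! k = x p"
    unfolding x using ij by (intro exI[of _ "i * N + j"]) (auto intro: nth_mat_data)
qed (auto simp: length_mat_data)

lemma computable_vec_input:
  "computable (carrier_vec N \<times> carrier_vec N \<times> UNIV \<times> carrier_vec N)
    (\<lambda>p. list_of_vec (fst p) @ triple_data (fst (snd p)) (fst (snd (snd p))) (snd (snd (snd p)))) 0
    (insert (\<lambda>p. fst (snd (snd p))) ((\<lambda>i p. fst p $ i) ` {..<N} \<union>
      (\<lambda>i p. fst (snd p) $ i) ` {..<N} \<union> (\<lambda>i p. snd (snd (snd p)) $ i) ` {..<N}))"
  by (rule computable_triple_input[where L = N and pre = "\<lambda>p. list_of_vec (fst p)"]) auto

section \<open>Programs for the products and for the inverse triple\<close>

lemma slp_mat_mult_rank_one_update: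
  assumes "N \<ge> 1"
  shows "\<exists>P. cost P \<le> 4 * N ^ 2 + 1 \<and>
    (\<forall>M\<in>carrier_mat N N. \<forall>u\<in>carrier_vec N. \<forall>a. \<forall>w\<in>carrier_vec N.
      run P (mat_data M @ triple_data u a w) = Some (mat_data (M * rank_one_update N u a w)))"
proof -
  let ?D = "carrier_mat N N \<times> carrier_vec N \<times> UNIV \<times> carrier_vec N"
  let ?u = "\<lambda>p. fst (snd p)" and ?a = "\<lambda>p. fst (snd (snd p))" and ?w = "\<lambda>p. snd (snd (snd p))"
  let ?z = "\<lambda>i j p. fst p $$ (i, j) + (\<Sum>k<N. fst p $$ (i, k) * ?u p $ k) * ((?a p - 1) * ?w p $ j)"
  have "\<exists>P. cost P \<le> 4 * N ^ 2 + 1 \<and> (\<forall>p\<in>?D.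
      run P (mat_data (fst p) @ triple_data (?u p) (?a p) (?w p)) =
        Some (map (\<lambda>x. x p) (concat (map (\<lambda>i. map (?z i) [0..<N]) [0..<N]))))"
    by (rule computable_run[OF computable_mat_right[OF computable_mat_input assms,
        where m = "\<lambda>i j p. fst p $$ (i, j)" and u = "\<lambda>i p. ?u p $ i" and w = "\<lambda>i p. ?w p $ i" and a = ?a]])
      auto
  then obtain P where "cost P \<le> 4 * N ^ 2 + 1"
    and P: "\<forall>p\<in>?D. run P (mat_data (fst p) @ triple_data (?u p) (?a p) (?w p)) =
        Some (map (\<lambda>x. x p) (concat (map (\<lambda>i. map (?z i) [0..<N]) [0..<N])))"
    by blast
  have "run P (mat_data M @ triple_data u a w) = Some (mat_data (M * rank_one_update N u a w))"
    if "M \<in> carrier_mat N N" "u \<in> carrier_vec N" "w \<in> carrier_vec N" for M u a w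
  proof -
    have "M * rank_one_update N u a w \<in> carrier_mat N N"
      using that(1) rank_one_update_carrier by (auto intro: mult_carrier_mat)
    \<comment> \<open>The list of program outputs \<open>?z\<close> is the closed form of the
      entries, taken in the row-major order of \<open>mat_data\<close>.\<close>
    then have "mat_data (M * rank_one_update N u a w) =
        concat (map (\<lambda>i. map (\<lambda>j. ?z i j (M, u, a, w)) [0..<N]) [0..<N])"
      using that by (auto simp: mat_data_eq mat_mult_rank_one_update simp del: index_mult_mat
        intro!: arg_cong[of _ _ concat])
    then show ?thesis
      using P[rule_format, of "(M, u, a, w)"] that by (simp add: map_concat o_def)
  qed
  with \<open>cost P \<le> 4 * N ^ 2 + 1\<close> show ?thesis by blast
qed

lemma slp_rank_one_update_mult_mat:
  assumes "N \<ge> 1"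
  shows "\<exists>P. cost P \<le> 4 * N ^ 2 + 1 \<and>
    (\<forall>M\<in>carrier_mat N N. \<forall>u\<in>carrier_vec N. \<forall>a. \<forall>w\<in>carrier_vec N.
      run P (mat_data M @ triple_data u a w) = Some (mat_data (rank_one_update N u a w * M)))"
proof -
  let ?D = "carrier_mat N N \<times> carrier_vec N \<times> UNIV \<times> carrier_vec N"
  let ?u = "\<lambda>p. fst (snd p)" and ?a = "\<lambda>p. fst (snd (snd p))" and ?w = "\<lambda>p. snd (snd (snd p))"
  let ?z = "\<lambda>i j p. fst p $$ (i, j) + (?a p - 1) * ?u p $ i * (\<Sum>k<N. ?w p $ k * fst p $$ (k, j))"
  have "\<exists>P. cost P \<le> 4 * N ^ 2 + 1 \<and> (\<forall>p\<in>?D.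
      run P (mat_data (fst p) @ triple_data (?u p) (?a p) (?w p)) =
        Some (map (\<lambda>x. x p) (concat (map (\<lambda>i. map (?z i) [0..<N]) [0..<N]))))"
    by (rule computable_run[OF computable_mat_left[OF computable_mat_input assms,
        where m = "\<lambda>i j p. fst p $$ (i, j)" and u = "\<lambda>i p. ?u p $ i" and w = "\<lambda>i p. ?w p $ i" and a = ?a]])
      auto
  then obtain P where "cost P \<le> 4 * N ^ 2 + 1"
    and P: "\<forall>p\<in>?D. run P (mat_data (fst p) @ triple_data (?u p) (?a p) (?w p)) =
        Some (map (\<lambda>x. x p) (concat (map (\<lambda>i. map (?z i) [0..<N]) [0..<N])))"
    by blast
  have "run P (mat_data M @ triple_data u a w) = Some (mat_data (rank_one_update N u a w * M))"
    if "M \<in> carrier_mat N N" "u \<in> carrier_vec N" "w \<in> carrier_vec N" for M u a w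
  proof -
    have "rank_one_update N u a w * M \<in> carrier_mat N N"
      using that(1) rank_one_update_carrier by (auto intro: mult_carrier_mat)
    then have "mat_data (rank_one_update N u a w * M) =
        concat (map (\<lambda>i. map (\<lambda>j. ?z i j (M, u, a, w)) [0..<N]) [0..<N])"
      using that by (auto simp: mat_data_eq rank_one_update_mult_mat simp del: index_mult_mat
        intro!: arg_cong[of _ _ concat])
    then show ?thesis
      using P[rule_format, of "(M, u, a, w)"] that by (simp add: map_concat o_def)
  qed
  with \<open>cost P \<le> 4 * N ^ 2 + 1\<close> show ?thesis by blast
qed

lemma slp_rank_one_update_mult_vec:
  assumes "N \<ge> 1"
  shows "\<exists>P. cost P \<le> 4 * N + 1 \<and>
    (\<forall>v\<in>carrier_vec N. \<forall>u\<in>carrier_vec N. \<forall>a. \<forall>w\<in>carrier_vec N.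
      run P (list_of_vec v @ triple_data u a w) =
        Some (list_of_vec (rank_one_update N u a w *\<^sub>v v)))"
proof -
  let ?D = "carrier_vec N \<times> carrier_vec N \<times> UNIV \<times> carrier_vec N"
  let ?u = "\<lambda>p. fst (snd p)" and ?a = "\<lambda>p. fst (snd (snd p))" and ?w = "\<lambda>p. snd (snd (snd p))"
  let ?z = "\<lambda>i p. fst p $ i + (?a p - 1) * (\<Sum>k<N. ?w p $ k * fst p $ k) * ?u p $ i"
  have "\<exists>P. cost P \<le> 4 * N + 1 \<and> (\<forall>p\<in>?D.
      run P (list_of_vec (fst p) @ triple_data (?u p) (?a p) (?w p)) =
        Some (map (\<lambda>x. x p) (map ?z [0..<N])))"
    by (rule computable_run[OF computable_vec[OF computable_vec_input assms,
        where v = "\<lambda>i p. fst p $ i" and u = "\<lambda>i p. ?u p $ i" and w = "\<lambda>i p. ?w p $ i" and a = ?a]])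
      auto
  then obtain P where "cost P \<le> 4 * N + 1"
    and P: "\<forall>p\<in>?D. run P (list_of_vec (fst p) @ triple_data (?u p) (?a p) (?w p)) =
        Some (map (\<lambda>x. x p) (map ?z [0..<N]))"
    by blast
  have "run P (list_of_vec v @ triple_data u a w) =
      Some (list_of_vec (rank_one_update N u a w *\<^sub>v v))"
    if "v \<in> carrier_vec N" "u \<in> carrier_vec N" "w \<in> carrier_vec N" for v u a w
  proof -
    have "list_of_vec (rank_one_update N u a w *\<^sub>v v) = map (\<lambda>i. ?z i (v, u, a, w)) [0..<N]"
      using that by (auto simp: list_of_vec_map rank_one_update_mult_vec simp del: index_mult_mat_vec)
    then show ?thesis
      using P[rule_format, of "(v, u, a, w)"] that by (simp add: o_def)
  qed
  with \<open>cost P \<le> 4 * N + 1\<close> show ?thesis by blast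
qed

lemma those_map_Some: "those (map Some xs) = Some xs"
  by (induction xs) auto

text \<open>The single instruction divides 1 by the scalar; column and row are passed on as outputs,
  which is free.\<close>

lemma slp_triple_inverse:
  "\<exists>P. (\<exists>a b. instrs P = [Instr Div a b]) \<and>
    (\<forall>u\<in>carrier_vec N. \<forall>a. \<forall>w\<in>carrier_vec N. a \<noteq> 0 \<longrightarrow>
      run P (triple_data u a w) = Some (triple_data u (inverse a) w))"
proof -
  \<comment> \<open>The input occupies cells 0 to \<open>2 * N\<close>, with the scalar at
    \<open>N\<close>, so the quotient is written to cell \<open>2 * N + 1\<close>.\<close>
  let ?out = "map Cell [0..<N] @ [Cell (2 * N + 1)] @ map (\<lambda>i. Cell (N + Suc i)) [0..<N]"
  let ?P = "SLP [Instr Div (Const 1) (Cell N)] ?out"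
  have "run ?P (triple_data u a w) = Some (triple_data u (inverse a) w)"
    if "u \<in> carrier_vec N" "w \<in> carrier_vec N" "a \<noteq> 0" for u a w
  proof -
    let ?mem = "triple_data u a w @ [inverse a]"
    have "map (read_operand ?mem) ?out = map Some (triple_data u (inverse a) w)"
      using that by (intro nth_equalityI)
        (auto simp: triple_data_def nth_append nth_Cons less_Suc_eq_le split: nat.split)
    then show ?thesis
      using that by (auto simp: run_def triple_data_def nth_append inverse_eq_divide those_map_Some
        simp del: map_append)
  qed
  then show ?thesis
    by (intro exI[of _ ?P]) auto
qed

section \<open>Assembly of the matrix identities and the operation counts\<close>

text \<open>The programs are chosen before the cone, the functional, the time and the basis. Their
  constants therefore cannot encode the data, which must be read from the input.\<close>

theorem mainTheorem2:
  fixes n d N :: nat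
  assumes "n \<ge> 1" and "N = dim (polys n d)"
  shows "N = (n + d) choose n \<and>
    (\<exists>P_inv P_MT P_TM P_MTi P_TiM P_Tv P_Tiv.
      (\<exists>a b. instrs P_inv = [Instr Div a b]) \<and>
      cost P_MT \<le> 4 * N^2 + 1 \<and> cost P_TM \<le> 4 * N^2 + 1 \<and>
      cost P_MTi \<le> 4 * N^2 + 1 \<and> cost P_TiM \<le> 4 * N^2 + 1 \<and>
      cost P_Tv \<le> 4 * N + 1 \<and> cost P_Tiv \<le> 4 * N + 1 \<and>
      (\<forall>(S :: mpoly set) (C :: mpoly set) (l :: mpoly \<Rightarrow> real) (f :: mpoly)
        (A :: mpoly \<Rightarrow> mpoly) (\<tau> :: real) (T :: mpoly \<Rightarrow> mpoly) (c :: real) (bs :: mpoly list)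
        (Tm :: real mat) (fv :: real vec) (lv :: real vec).
        S \<subseteq> polys n d \<longrightarrow>
        C \<subseteq> polys n d \<longrightarrow> is_cone C \<longrightarrow> full_dim n d C \<longrightarrow>
        linear_functional_on (polys n d) l \<longrightarrow>
        (\<forall>p \<in> ((poly_top n d closure_of cone_of S) \<union> C) - {0}. l p > 0) \<longrightarrow>
        f \<in> poly_top n d interior_of C \<longrightarrow>
        A = (\<lambda>p. l p *\<^sub>R f) \<longrightarrow>
        \<tau> > 0 \<longrightarrow>
        (\<forall>t \<ge> \<tau>. endo_exp n d (\<lambda>p. t *\<^sub>R A p) ` S \<subseteq> C) \<longrightarrow>
        T = endo_exp n d (\<lambda>p. \<tau> *\<^sub>R A p) \<longrightarrow>
        c = exp (\<tau> * l f) \<longrightarrow>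
        is_basis (polys n d) bs \<longrightarrow>
        Tm = matrix_in bs T \<longrightarrow>
        fv = coord_vec bs (inverse (l f) *\<^sub>R f) \<longrightarrow>
        lv = functional_vec bs l \<longrightarrow>
        Tm \<in> carrier_mat N N \<and> fv \<in> carrier_vec N \<and> lv \<in> carrier_vec N \<and>
        length (triple_data fv c lv) = 2 * N + 1 \<and>
        Tm = 1\<^sub>m N + (c - 1) \<cdot>\<^sub>m col_times_row N fv lv \<and>
        (\<exists>Ti \<in> carrier_mat N N.
          inverts_mat Tm Ti \<and> inverts_mat Ti Tm \<and>
          Ti = 1\<^sub>m N + (inverse c - 1) \<cdot>\<^sub>m col_times_row N fv lv \<and>
          run P_inv (triple_data fv c lv) = Some (triple_data fv (inverse c) lv) \<and>
          (\<forall>M \<in> carrier_mat N N.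
            run P_MT (mat_data M @ triple_data fv c lv) = Some (mat_data (M * Tm)) \<and>
            run P_TM (mat_data M @ triple_data fv c lv) = Some (mat_data (Tm * M)) \<and>
            run P_MTi (mat_data M @ triple_data fv (inverse c) lv) = Some (mat_data (M * Ti)) \<and>
            run P_TiM (mat_data M @ triple_data fv (inverse c) lv) = Some (mat_data (Ti * M))) \<and>
          (\<forall>v \<in> carrier_vec N.
            run P_Tv (list_of_vec v @ triple_data fv c lv) =
              Some (list_of_vec (Tm *\<^sub>v v)) \<and>
            run P_Tiv (list_of_vec v @ triple_data fv (inverse c) lv) =
              Some (list_of_vec (Ti *\<^sub>v v))))))"
proof -
  \<comment> \<open>Positivity of the binomial coefficient gives \<open>N \<ge> 1\<close>, as the
    programs with inner products require.\<close>
  have N: "N = (n + d) choose n" and "N \<ge> 1"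
    using assms(2) by (auto simp: dim_polys Suc_le_eq)
  obtain P_inv where inv: "\<exists>a b. instrs P_inv = [Instr Div a b]"
    "\<And>u a w. u \<in> carrier_vec N \<Longrightarrow> w \<in> carrier_vec N \<Longrightarrow> a \<noteq> 0 \<Longrightarrow>
      run P_inv (triple_data u a w) = Some (triple_data u (inverse a) w)"
    using slp_triple_inverse[of N] by blast
  obtain P_MT where MT: "cost P_MT \<le> 4 * N^2 + 1"
    "\<And>M u a w. M \<in> carrier_mat N N \<Longrightarrow> u \<in> carrier_vec N \<Longrightarrow> w \<in> carrier_vec N \<Longrightarrow>
      run P_MT (mat_data M @ triple_data u a w) = Some (mat_data (M * rank_one_update N u a w))"
    using slp_mat_mult_rank_one_update[OF \<open>N \<ge> 1\<close>] by blast
  obtain P_TM where TM: "cost P_TM \<le> 4 * N^2 + 1"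
    "\<And>M u a w. M \<in> carrier_mat N N \<Longrightarrow> u \<in> carrier_vec N \<Longrightarrow> w \<in> carrier_vec N \<Longrightarrow>
      run P_TM (mat_data M @ triple_data u a w) = Some (mat_data (rank_one_update N u a w * M))"
    using slp_rank_one_update_mult_mat[OF \<open>N \<ge> 1\<close>] by blast
  obtain P_Tv where Tv: "cost P_Tv \<le> 4 * N + 1"
    "\<And>v u a w. v \<in> carrier_vec N \<Longrightarrow> u \<in> carrier_vec N \<Longrightarrow> w \<in> carrier_vec N \<Longrightarrow>
      run P_Tv (list_of_vec v @ triple_data u a w) =
        Some (list_of_vec (rank_one_update N u a w *\<^sub>v v))"
    using slp_rank_one_update_mult_vec[OF \<open>N \<ge> 1\<close>] by blast
  show ?thesis
  \<comment> \<open>\<open>P_MT\<close>, \<open>P_TM\<close> and \<open>P_Tv\<close> are each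
    supplied twice: the inverse is an update with the same column and row and scalar
    \<open>inverse c\<close>.\<close>
  proof (rule conjI[OF N], rule exI[of _ P_inv], rule exI[of _ P_MT], rule exI[of _ P_TM],
      rule exI[of _ P_MT], rule exI[of _ P_TM], rule exI[of _ P_Tv], rule exI[of _ P_Tv],
      intro conjI inv(1) MT(1) TM(1) Tv(1), goal_cases)
    case 1
    show ?case
    proof (intro allI impI, goal_cases)
      case (1 S C l f A \<tau> T c bs Tm fv lv)
      note l = 1(5) and bs = 1(13)
      have f: "f \<in> polys n d" "l f > 0"
        using interior_point_pos[OF 1(2) l _ 1(7)] 1(6) by auto
      let ?g = "inverse (l f) *\<^sub>R f"
      have g: "?g \<in> polys n d"
        by (intro subspace_scale subspace_polys f(1))
      have len: "length bs = N"
        using length_basis_eq_dim[OF bs] assms(2) by simp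
      have carrier: "fv \<in> carrier_vec N" "lv \<in> carrier_vec N"
        unfolding 1(15,16) len[symmetric] by simp_all
      have "T p = p + ((c - 1) * l p) *\<^sub>R ?g" if "p \<in> polys n d" for p
        unfolding 1(8,11,12) using that f by (intro endo_exp_rank_one[OF l]) auto
      then have Tm: "Tm = rank_one_update N fv c lv"
        unfolding 1(14-16) len[symmetric] by (intro matrix_in_rank_one_update[OF bs g])
      have "c > 0" using 1(12) by simp
      have "(\<Sum>k<N. lv $ k * fv $ k) = l ?g"
        unfolding 1(15,16) len[symmetric] by (rule functional_vec_coord_vec[OF bs l g])
      \<comment> \<open>Dividing \<open>f\<close> by \<open>l f\<close> serves this purpose:
        homogeneity gives value 1 at \<open>?g\<close>.\<close>
      also have "\<dots> = 1"
        using linear_functional_onD(2)[OF l f(1)] f(2) by simp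
      finally have dot: "(\<Sum>k<N. lv $ k * fv $ k) = 1" .
      let ?Ti = "rank_one_update N fv (inverse c) lv"
      \<comment> \<open>The left inverse is the same fact with \<open>inverse c\<close> in place of
        \<open>c\<close>.\<close>
      have inverse: "inverts_mat Tm ?Ti" "inverts_mat ?Ti Tm"
        using rank_one_update_inverse[OF _ dot, of c] rank_one_update_inverse[OF _ dot, of "inverse c"]
          \<open>c > 0\<close> by (simp_all add: Tm inverts_mat_def)
      have c: "c \<noteq> 0" using \<open>c > 0\<close> by simp
      have length: "length (triple_data fv c lv) = 2 * N + 1"
        using carrier by (simp add: triple_data_def)
      show ?case
        by (intro conjI bexI[of _ ?Ti] ballI carrier length inverse;
            simp only: Tm rank_one_update_carrier rank_one_update_def[symmetric]
              inv(2) MT(2) TM(2) Tv(2) carrier c simp_thms not_False_eq_True)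
    qed
  qed
qed

end
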